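(* Let $0<p<\infty$, let $\boldsymbol\alpha=(\alpha_1,\dots,\alpha_n)\in\mathbb{R}^n$ with $\alpha_k\notin\pi\mathbb{Z}$ for $k=1,\dots,n$, let $T$ be a singular integral operator with kernel $K$, and let $T_{\boldsymbol\alpha}$ be the associated singular integral operator with chirp functions. Then $T_{\boldsymbol\alpha}$ is bounded from $H^p_{\boldsymbol\alpha}(\mathbb{R}^n)$ to $H^p_{\boldsymbol\alpha}(\mathbb{R}^n)$ if and only if $T$ is bounded from $H^p(\mathbb{R}^n)$ to $H^p(\mathbb{R}^n)$.
   Context: For $\boldsymbol\alpha\in\mathbb{R}^n$ with all $\alpha_k\notin\pi\mathbb{Z}$, the chirp is $e_{\boldsymbol\alpha}(\boldsymbol x)=\exp\big(\tfrac{i}{2}\sum_{k=1}^n x_k^2\cot\alpha_k\big)$, so $e_{-\boldsymbol\alpha}=1/e_{\boldsymbol\alpha}$. The singular integral operator with kernel $K$ is $T(f)(\boldsymbol x)=\mathrm{p.v.}\int_{\mathbb{R}^n}K(\boldsymbol x,\boldsymbol y)f(\boldsymbol y)\,d\boldsymbol y$, and the associated operator with chirp functions is $T_{\boldsymbol\alpha}(f)(\boldsymbol x)=\mathrm{p.v.}\int_{\mathbb{R}^n}e_{-\boldsymbol\alpha}(\boldsymbol x)K(\boldsymbol x,\boldsymbol y)e_{\boldsymbol\alpha}(\boldsymbol y)f(\boldsymbol y)\,d\boldsymbol y$, that is, $T_{\boldsymbol\alpha}f=e_{-\boldsymbol\alpha}T(e_{\boldsymbol\alpha}f)$. Let $P_t$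 ($t>0$) be the Poisson kernel on $\mathbb{R}^n$. A tempered distribution $h$ is bounded if $\varphi*h\in L^\infty$ for every Schwartz function $\varphi$. A bounded tempered distribution $f$ lies in the Hardy space $H^p(\mathbb{R}^n)$ if $\sup_{t>0}|P_t*f|\in L^p(\mathbb{R}^n)$, with $\|f\|_{H^p}=\|\sup_{t>0}|P_t*f|\|_{L^p}$. A bounded tempered distribution $f$ lies in the chirp Hardy space $H^p_{\boldsymbol\alpha}(\mathbb{R}^n)$ if $\sup_{t>0}|P_t*(e_{\boldsymbol\alpha}f)|\in L^p(\mathbb{R}^n)$, with $\|f\|_{H^p_{\boldsymbol\alpha}}=\|\sup_{t>0}|P_t*(e_{\boldsymbol\alpha}f)|\|_{L^p}$. An operator $A$ is bounded from $Y$ to $Y$ if $\|Af\|_Y\le C\|f\|_Y$ with $C$ independent of $f$.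
   Formalization: In the definition of the chirp Hardy space, boundedness is required of the product of the chirp with f (f itself only a tempered distribution) instead of f; for p<1 the literal definition is ill-defined or makes the claim false, for p≥1 the two agree. *)

theory Defs
  imports "HOL-Analysis.Analysis"
begin

definition partial_deriv :: "'n::finite \<Rightarrow> (real^'n \<Rightarrow> complex) \<Rightarrow> real^'n \<Rightarrow> complex" where
  "partial_deriv i f x = frechet_derivative f (at x) (axis i 1)"

text \<open>A multi-index derivative is a list of coordinate directions. A function is smooth iff all
  its iterated partial derivatives exist and are Frechet differentiable everywhere.\<close>

abbreviation iter_partial :: "'n::finite list \<Rightarrow> (real^'n \<Rightarrow> complex) \<Rightarrow> real^'n \<Rightarrow> complex" where
  "iter_partial is f \<equiv> foldr partial_deriv is f"

definition schwartz :: "(real^'n::finite \<Rightarrow> complex) \<Rightarrow> bool" where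
  "schwartz f \<longleftrightarrow>
     (\<forall>is. (\<forall>x. iter_partial is f differentiable (at x)) \<and>
           (\<forall>N::nat. bounded (range (\<lambda>x. (1 + norm x) ^ N *\<^sub>R iter_partial is f x))))"

definition schwartz_null :: "(nat \<Rightarrow> real^'n::finite \<Rightarrow> complex) \<Rightarrow> bool" where
  "schwartz_null F \<longleftrightarrow>
     (\<forall>k. schwartz (F k)) \<and>
     (\<forall>is. \<forall>N::nat. uniform_limit UNIV
        (\<lambda>k x. (1 + norm x) ^ N *\<^sub>R iter_partial is (F k) x) (\<lambda>x. 0) sequentially)"

type_synonym 'n distr = "(real^'n \<Rightarrow> complex) \<Rightarrow> complex"

text \<open>The Schwartz space is metrizable, so sequential continuity is continuity. A functional on
  Schwartz functions is given the value 0 off the Schwartz space, so that two tempered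
  distributions are equal iff they are equal as HOL functions.\<close>

definition tempered :: "'n::finite distr \<Rightarrow> bool" where
  "tempered u \<longleftrightarrow>
     (\<forall>\<phi> \<psi>. schwartz \<phi> \<longrightarrow> schwartz \<psi> \<longrightarrow> u (\<lambda>x. \<phi> x + \<psi> x) = u \<phi> + u \<psi>) \<and>
     (\<forall>c \<phi>. schwartz \<phi> \<longrightarrow> u (\<lambda>x. c * \<phi> x) = c * u \<phi>) \<and>
     (\<forall>F. schwartz_null F \<longrightarrow> (\<lambda>k. u (F k)) \<longlonglongrightarrow> 0) \<and>
     (\<forall>\<phi>. \<not> schwartz \<phi> \<longrightarrow> u \<phi> = 0)"

definition tempered_fun :: "(real^'n::finite \<Rightarrow> complex) \<Rightarrow> bool" where
  "tempered_fun f \<longleftrightarrow> (\<exists>N::nat. integrable lebesgue (\<lambda>x. f x /\<^sub>R (1 + norm x) ^ N))"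

definition distr_of_fun :: "(real^'n::finite \<Rightarrow> complex) \<Rightarrow> 'n distr" where
  "distr_of_fun f \<phi> = (if schwartz \<phi> then LINT x|lebesgue. f x * \<phi> x else 0)"

definition conv_distr :: "(real^'n::finite \<Rightarrow> complex) \<Rightarrow> 'n distr \<Rightarrow> real^'n \<Rightarrow> complex" where
  "conv_distr \<phi> h x = h (\<lambda>y. \<phi> (x - y))"

definition bounded_distr :: "'n::finite distr \<Rightarrow> bool" where
  "bounded_distr h \<longleftrightarrow> tempered h \<and>
     (\<forall>\<phi>. schwartz \<phi> \<longrightarrow> (\<exists>C. AE x in lebesgue. norm (conv_distr \<phi> h x) \<le> C))"

definition poisson_kernel :: "real \<Rightarrow> real^'n::finite \<Rightarrow> real" where
  "poisson_kernel t x =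
     Gamma ((real CARD('n) + 1) / 2) / pi powr ((real CARD('n) + 1) / 2) *
     (t / (t\<^sup>2 + (norm x)\<^sup>2) powr ((real CARD('n) + 1) / 2))"

text \<open>For a bounded tempered distribution \<open>h\<close>, the distribution \<open>P\<^sub>t * h\<close> is given by
  \<open>\<langle>P\<^sub>t * h, \<phi>\<rangle> = \<integral> (\<phi>\<^sup>\<sim> * h)(x) P\<^sub>t(- x) dx\<close> with \<open>\<phi>\<^sup>\<sim>(x) = \<phi>(- x)\<close>, the integral being
  absolutely convergent since \<open>\<phi>\<^sup>\<sim> * h\<close> is bounded and \<open>P\<^sub>t\<close> is integrable. This distribution is a
  bounded smooth function; \<open>poisson_conv t h\<close> is that function (the unique bounded continuous one
  representing the distribution). It is meaningful only for bounded \<open>h\<close>.\<close>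

definition poisson_conv :: "real \<Rightarrow> 'n::finite distr \<Rightarrow> real^'n \<Rightarrow> complex" where
  "poisson_conv t h = (THE u. continuous_on UNIV u \<and> bounded (range u) \<and>
     (\<forall>\<phi>. schwartz \<phi> \<longrightarrow>
        (LINT x|lebesgue. u x * \<phi> x) =
        (LINT x|lebesgue. conv_distr (\<lambda>y. \<phi> (- y)) h x * of_real (poisson_kernel t (- x)))))"

definition poisson_max :: "'n::finite distr \<Rightarrow> real^'n \<Rightarrow> ennreal" where
  "poisson_max h x = (SUP t\<in>{0<..}. ennreal (norm (poisson_conv t h x)))"

definition ennreal_pow :: "ennreal \<Rightarrow> real \<Rightarrow> ennreal" where
  "ennreal_pow a p = (if a = \<infinity> then \<infinity> else ennreal (enn2real a powr p))"

definition Lp_norm :: "real \<Rightarrow> (real^'n::finite \<Rightarrow> ennreal) \<Rightarrow> ennreal" where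
  "Lp_norm p g = ennreal_pow (\<integral>\<^sup>+ x. ennreal_pow (g x) p \<partial>lebesgue) (1 / p)"

definition in_Lp :: "real \<Rightarrow> (real^'n::finite \<Rightarrow> ennreal) \<Rightarrow> bool" where
  "in_Lp p g \<longleftrightarrow> g \<in> borel_measurable lebesgue \<and> Lp_norm p g < \<infinity>"

definition hardy_norm :: "real \<Rightarrow> 'n::finite distr \<Rightarrow> ennreal" where
  "hardy_norm p h = Lp_norm p (poisson_max h)"

definition hardy_space :: "real \<Rightarrow> 'n::finite distr set" where
  "hardy_space p = {h. bounded_distr h \<and> in_Lp p (poisson_max h)}"

definition chirp :: "real^'n::finite \<Rightarrow> real^'n \<Rightarrow> complex" where
  "chirp \<alpha> x = exp (\<i> / 2 * of_real (\<Sum>k\<in>UNIV. (x $ k)\<^sup>2 * cot (\<alpha> $ k)))"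

text \<open>The product of the smooth function \<open>chirp \<alpha>\<close> with a tempered distribution. A function \<open>\<phi>\<close> is
  Schwartz iff \<open>chirp \<alpha> \<cdot> \<phi>\<close> is (see \<open>schwartz_chirp_iff\<close> below), so the product again vanishes
  off the Schwartz space.\<close>

definition chirp_mult :: "real^'n::finite \<Rightarrow> 'n distr \<Rightarrow> 'n distr" where
  "chirp_mult \<alpha> u = (\<lambda>\<phi>. u (\<lambda>x. chirp \<alpha> x * \<phi> x))"

definition chirp_hardy_norm :: "real^'n::finite \<Rightarrow> real \<Rightarrow> 'n distr \<Rightarrow> ennreal" where
  "chirp_hardy_norm \<alpha> p f = Lp_norm p (poisson_max (chirp_mult \<alpha> f))"

text \<open>The convolution of \<open>P\<^sub>t\<close> with \<open>chirp \<alpha> \<cdot> f\<close> is defined when the distribution \<open>chirp \<alpha> \<cdot> f\<close> is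
  bounded, and this is where boundedness is required. It neither implies nor follows from
  boundedness of \<open>f\<close> itself: in dimension 1 with \<open>cot \<alpha> \<noteq> 0\<close>, \<open>chirp (- \<alpha>)'\<close> is bounded but its product with
  \<open>chirp \<alpha>\<close>, a linear function, is not. Where \<open>p \<ge> 1\<close> the two requirements agree, because there
  membership makes \<open>chirp \<alpha> \<cdot> f\<close>, hence also \<open>f\<close>, a function in \<open>L\<^sup>p\<close>.\<close>

definition chirp_hardy_space :: "real^'n::finite \<Rightarrow> real \<Rightarrow> 'n distr set" where
  "chirp_hardy_space \<alpha> p =
     {f. tempered f \<and> bounded_distr (chirp_mult \<alpha> f) \<and> in_Lp p (poisson_max (chirp_mult \<alpha> f))}"

text \<open>\<open>g(x) = p.v. \<integral> K(x,y) f(y) dy\<close> for almost every \<open>x\<close>.\<close>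

definition is_pv_integral ::
  "(real^'n::finite \<Rightarrow> real^'n \<Rightarrow> complex) \<Rightarrow> (real^'n \<Rightarrow> complex) \<Rightarrow> (real^'n \<Rightarrow> complex) \<Rightarrow> bool" where
  "is_pv_integral K f g \<longleftrightarrow>
     (AE x in lebesgue.
        (\<forall>\<epsilon>>0. set_integrable lebesgue {y. \<epsilon> < dist x y} (\<lambda>y. K x y * f y)) \<and>
        ((\<lambda>\<epsilon>. LINT y:{y. \<epsilon> < dist x y}|lebesgue. K x y * f y) \<longlongrightarrow> g x) (at_right 0))"

text \<open>\<open>T\<close> acts on distributions, because elements of \<open>H\<^sup>p\<close> need not be functions. On a function it
  is given by the principal value integral whenever this makes sense, that is, exists almost
  everywhere and defines a distribution. On other arguments the kernel prescribes nothing; in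
  particular \<open>T\<close> may take arbitrary values outside its natural domain.\<close>

definition singular_integral_operator ::
  "(real^'n::finite \<Rightarrow> real^'n \<Rightarrow> complex) \<Rightarrow> ('n distr \<Rightarrow> 'n distr) \<Rightarrow> bool" where
  "singular_integral_operator K T \<longleftrightarrow>
     (\<forall>f g. tempered_fun f \<longrightarrow> tempered_fun g \<longrightarrow> is_pv_integral K f g \<longrightarrow>
        T (distr_of_fun f) = distr_of_fun g)"

text \<open>\<open>chirp_operator \<alpha> T\<close> is \<open>T\<^sub>\<alpha> f = e\<^bsub>-\<alpha>\<^esub> T(e\<^bsub>\<alpha>\<^esub> f)\<close>. By \<open>singular_integral_chirp_operator\<close> below it is
  the operator given by the principal value integral with kernel \<open>chirp_kernel \<alpha> K\<close>.\<close>

definition chirp_operator :: "real^'n::finite \<Rightarrow> ('n distr \<Rightarrow> 'n distr) \<Rightarrow> 'n distr \<Rightarrow> 'n distr" where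
  "chirp_operator \<alpha> T f = chirp_mult (- \<alpha>) (T (chirp_mult \<alpha> f))"

definition chirp_kernel ::
  "real^'n::finite \<Rightarrow> (real^'n \<Rightarrow> real^'n \<Rightarrow> complex) \<Rightarrow> real^'n \<Rightarrow> real^'n \<Rightarrow> complex" where
  "chirp_kernel \<alpha> K x y = chirp (- \<alpha>) x * K x y * chirp \<alpha> y"

definition bounded_operator_on ::
  "'n::finite distr set \<Rightarrow> ('n distr \<Rightarrow> ennreal) \<Rightarrow> ('n distr \<Rightarrow> 'n distr) \<Rightarrow> bool" where
  "bounded_operator_on Y N A \<longleftrightarrow>
     (\<exists>C::real. C \<ge> 0 \<and> (\<forall>f\<in>Y. A f \<in> Y \<and> N (A f) \<le> ennreal C * N f))"


lemma chirp_uminus: "chirp (- \<alpha>) x = 1 / chirp \<alpha> x"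
  by (simp add: chirp_def sum_negf exp_minus field_simps)

lemma chirp_nonzero [simp]: "chirp \<alpha> x \<noteq> 0"
  by (simp add: chirp_def)

lemma chirp_cancel [simp]:
  "chirp \<alpha> x * (chirp (- \<alpha>) x * z) = z" "chirp (- \<alpha>) x * (chirp \<alpha> x * z) = z"
  by (simp_all add: chirp_uminus)

lemma norm_chirp [simp]: "norm (chirp \<alpha> x) = 1"
  by (simp add: chirp_def norm_exp_eq_Re)

lemma schwartz_differentiable: "schwartz f \<Longrightarrow> f differentiable (at x)"
  unfolding schwartz_def by (drule spec[of _ "[]"]) simp

lemma schwartz_decay: "schwartz f \<Longrightarrow> bounded (range (\<lambda>x. (1 + norm x) ^ N *\<^sub>R f x))"
  unfolding schwartz_def by (drule spec[of _ "[]"]) simp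

lemma schwartz_partial:
  assumes "schwartz f"
  shows "schwartz (partial_deriv i f)"
proof -
  have "iter_partial is (partial_deriv i f) = iter_partial (is @ [i]) f" for "is"
    by simp
  then show ?thesis
    using assms unfolding schwartz_def by presburger
qed

lemma schwartz_coinduct:
  assumes "f \<in> X"
    and "\<And>f x. f \<in> X \<Longrightarrow> f differentiable (at x)"
    and "\<And>f N. f \<in> X \<Longrightarrow> bounded (range (\<lambda>x. (1 + norm x) ^ N *\<^sub>R f x))"
    and "\<And>f i. f \<in> X \<Longrightarrow> partial_deriv i f \<in> X"
  shows "schwartz f"
proof -
  have "iter_partial is f \<in> X" for "is"
    by (induction "is") (simp_all add: assms)
  then show ?thesis
    unfolding schwartz_def using assms by blast
qed

lemma partial_deriv_eq:
  "(f has_derivative f') (at x) \<Longrightarrow> partial_deriv i f x = f' (axis i 1)"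
  unfolding partial_deriv_def by (metis frechet_derivative_at)

lemma has_derivative_frechet:
  "f differentiable (at x) \<Longrightarrow> (f has_derivative frechet_derivative f (at x)) (at x)"
  by (simp add: frechet_derivative_works)

lemma schwartz_add:
  assumes "schwartz f" "schwartz g"
  shows "schwartz (\<lambda>x. f x + c * g x)"
proof (rule schwartz_coinduct[where X = "{\<lambda>x. f x + c * g x |f g. schwartz f \<and> schwartz g}"])
  show "(\<lambda>x. f x + c * g x) \<in> {\<lambda>x. f x + c * g x |f g. schwartz f \<and> schwartz g}"
    using assms by blast
next
  fix h :: "real^'n \<Rightarrow> complex" and x
  assume "h \<in> {\<lambda>x. f x + c * g x |f g. schwartz f \<and> schwartz g}"
  then obtain f g where h: "h = (\<lambda>x. f x + c * g x)" "schwartz f" "schwartz g" by blast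
  show "h differentiable (at x)"
    unfolding h(1) by (intro differentiable_add differentiable_mult differentiable_const)
      (simp_all add: h schwartz_differentiable)
next
  fix h :: "real^'n \<Rightarrow> complex" and N
  assume "h \<in> {\<lambda>x. f x + c * g x |f g. schwartz f \<and> schwartz g}"
  then obtain f g where h: "h = (\<lambda>x. f x + c * g x)" "schwartz f" "schwartz g" by blast
  obtain A B where A: "\<And>x. norm ((1 + norm x) ^ N *\<^sub>R f x) \<le> A"
    and B: "\<And>x. norm ((1 + norm x) ^ N *\<^sub>R g x) \<le> B"
    using schwartz_decay[OF h(2), of N] schwartz_decay[OF h(3), of N]
    unfolding bounded_iff by blast
  have "norm ((1 + norm x) ^ N *\<^sub>R h x) \<le> A + norm c * B" for x
  proof -
    have "(1 + norm x) ^ N *\<^sub>R h x = (1 + norm x) ^ N *\<^sub>R f x + c * ((1 + norm x) ^ N *\<^sub>R g x)"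
      by (simp add: h scaleR_add_right)
    also have "norm \<dots> \<le> norm ((1 + norm x) ^ N *\<^sub>R f x) + norm c * norm ((1 + norm x) ^ N *\<^sub>R g x)"
      by (metis norm_triangle_ineq norm_mult)
    also have "\<dots> \<le> A + norm c * B"
      by (intro add_mono mult_left_mono A B norm_ge_zero)
    finally show ?thesis .
  qed
  then show "bounded (range (\<lambda>x. (1 + norm x) ^ N *\<^sub>R h x))"
    unfolding bounded_iff by blast
next
  fix h :: "real^'n \<Rightarrow> complex" and i
  assume "h \<in> {\<lambda>x. f x + c * g x |f g. schwartz f \<and> schwartz g}"
  then obtain f g where h: "h = (\<lambda>x. f x + c * g x)" "schwartz f" "schwartz g" by blast
  have "partial_deriv i h x = partial_deriv i f x + c * partial_deriv i g x" for x
  proof -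
    have "(h has_derivative
        (\<lambda>v. frechet_derivative f (at x) v + c * frechet_derivative g (at x) v)) (at x)"
      unfolding h(1) using h(2,3)
      by (intro has_derivative_add has_derivative_mult_right has_derivative_frechet
          schwartz_differentiable)
    from partial_deriv_eq[OF this] show ?thesis by (simp add: partial_deriv_def)
  qed
  then have "partial_deriv i h = (\<lambda>x. partial_deriv i f x + c * partial_deriv i g x)" by blast
  then show "partial_deriv i h \<in> {\<lambda>x. f x + c * g x |f g. schwartz f \<and> schwartz g}"
    using schwartz_partial[OF h(2), of i] schwartz_partial[OF h(3), of i]
    by (intro CollectI exI conjI)
qed

lemma schwartz_zero: "schwartz (\<lambda>x::real^'n. 0)"
proof (rule schwartz_coinduct[where X = "{\<lambda>x. 0}"])
  fix f :: "real^'n \<Rightarrow> complex" and i assume "f \<in> {\<lambda>x. 0}"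
  then show "partial_deriv i f \<in> {\<lambda>x. 0}"
    using partial_deriv_eq[of "\<lambda>x::real^'n. 0::complex" "\<lambda>v. 0"] by fastforce
qed (auto simp: bounded_iff)

lemma schwartz_coord:
  fixes f :: "real^'n \<Rightarrow> complex"
  assumes "schwartz f"
  shows "schwartz (\<lambda>x. of_real (x $ j) * f x)"
proof (rule schwartz_coinduct
    [where X = "{\<lambda>x. of_real (x $ j) * f x + g x |f g. schwartz f \<and> schwartz g}"])
  let ?X = "{\<lambda>x::real^'n. of_real (x $ j) * f x + g x |f g. schwartz f \<and> schwartz g}"
  show "(\<lambda>x. of_real (x $ j) * f x) \<in> ?X"
    using assms schwartz_zero by (intro CollectI exI[of _ f] exI[of _ "\<lambda>x. 0"]) auto
  fix h :: "real^'n \<Rightarrow> complex"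
  assume "h \<in> ?X"
  then obtain f g where h: "h = (\<lambda>x. of_real (x $ j) * f x + g x)" "schwartz f" "schwartz g"
    by blast
  have der: "(h has_derivative (\<lambda>v. of_real (x $ j) * frechet_derivative f (at x) v
       + of_real (v $ j) * f x + frechet_derivative g (at x) v)) (at x)" for x
    unfolding h(1)
    by (intro has_derivative_add has_derivative_mult has_derivative_of_real has_derivative_frechet
          schwartz_differentiable h bounded_linear.has_derivative[OF bounded_linear_vec_nth]
          has_derivative_ident)
  show "h differentiable (at x)" for x
    using der unfolding differentiable_def by blast
  show "partial_deriv i h \<in> ?X" for i
  proof -
    have "partial_deriv i h = (\<lambda>x. of_real (x $ j) * partial_deriv i f x
        + (partial_deriv i g x + of_real (axis i 1 $ j) * f x))"
      using partial_deriv_eq[OF der] by (auto simp: partial_deriv_def)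
    moreover have "schwartz (\<lambda>x. partial_deriv i g x + of_real (axis i 1 $ j) * f x)"
      by (intro schwartz_add schwartz_partial h)
    ultimately show ?thesis
      using schwartz_partial[OF h(2), of i] by (intro CollectI exI conjI)
  qed
  show "bounded (range (\<lambda>x. (1 + norm x) ^ N *\<^sub>R h x))" for N
  proof -
    obtain A B where A: "\<And>x. norm ((1 + norm x) ^ Suc N *\<^sub>R f x) \<le> A"
      and B: "\<And>x. norm ((1 + norm x) ^ N *\<^sub>R g x) \<le> B"
      using schwartz_decay[OF h(2), of "Suc N"] schwartz_decay[OF h(3), of N]
      unfolding bounded_iff by blast
    have "norm ((1 + norm x) ^ N *\<^sub>R h x) \<le> A + B" for x
    proof -
      have "norm ((1 + norm x) ^ N *\<^sub>R h x)
          \<le> (1 + norm x) ^ N * (\<bar>x $ j\<bar> * norm (f x)) + norm ((1 + norm x) ^ N *\<^sub>R g x)"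
        unfolding h(1) scaleR_add_right
        by (rule order_trans[OF norm_triangle_ineq]) (simp add: norm_mult)
      also have "(1 + norm x) ^ N * (\<bar>x $ j\<bar> * norm (f x)) \<le> norm ((1 + norm x) ^ Suc N *\<^sub>R f x)"
      proof -
        have "\<bar>x $ j\<bar> \<le> 1 + norm x" using component_le_norm_cart[of x j] by simp
        then have "(1 + norm x) ^ N * (\<bar>x $ j\<bar> * norm (f x))
            \<le> (1 + norm x) ^ N * ((1 + norm x) * norm (f x))"
          by (intro mult_left_mono mult_right_mono) auto
        also have "\<dots> = norm ((1 + norm x) ^ Suc N *\<^sub>R f x)"
          unfolding norm_scaleR by (simp add: mult.assoc mult.left_commute)
        finally show ?thesis .
      qed
      finally show ?thesis using A[of x] B[of x] by linarith
    qed
    then show ?thesis unfolding bounded_iff by blast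
  qed
qed

lemma has_derivative_chirp:
  "(chirp \<alpha> has_derivative
     (\<lambda>v. chirp \<alpha> x * (\<i> * of_real (\<Sum>k\<in>UNIV. cot (\<alpha> $ k) * x $ k * v $ k)))) (at x)"
proof -
  have "((\<lambda>x. \<Sum>k\<in>UNIV. (x $ k)\<^sup>2 * cot (\<alpha> $ k)) has_derivative
      (\<lambda>v. 2 * (\<Sum>k\<in>UNIV. cot (\<alpha> $ k) * x $ k * v $ k))) (at x)"
    by (auto intro!: derivative_eq_intros bounded_linear.has_derivative[OF bounded_linear_vec_nth]
        simp: sum_distrib_left ac_simps)
  from has_derivative_of_real[OF this, where 'a = complex]
  have "((\<lambda>x. \<i> / 2 * of_real (\<Sum>k\<in>UNIV. (x $ k)\<^sup>2 * cot (\<alpha> $ k))) has_derivative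
      (\<lambda>v. \<i> / 2 * of_real (2 * (\<Sum>k\<in>UNIV. cot (\<alpha> $ k) * x $ k * v $ k)))) (at x)"
    by (rule has_derivative_mult_right)
  from has_derivative_compose[OF this DERIV_exp[unfolded has_field_derivative_def]]
  show ?thesis unfolding chirp_def[abs_def] by (simp add: mult.assoc)
qed

lemma schwartz_sum:
  "finite S \<Longrightarrow> (\<And>k. k \<in> S \<Longrightarrow> schwartz (f k)) \<Longrightarrow> schwartz (\<lambda>x. \<Sum>k\<in>S. f k x)"
proof (induction S rule: finite_induct)
  case empty
  then show ?case by (simp add: schwartz_zero)
next
  case (insert k S)
  then show ?case using schwartz_add[of "f k" "\<lambda>x. \<Sum>k\<in>S. f k x" 1] by simp
qed

lemma schwartz_chirp:
  fixes f :: "real^'n \<Rightarrow> complex"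
  assumes "schwartz f"
  shows "schwartz (\<lambda>x. chirp \<alpha> x * f x)"
proof (rule schwartz_coinduct[where X = "{\<lambda>x. chirp \<alpha> x * f x |f. schwartz f}"])
  let ?X = "{\<lambda>x. chirp \<alpha> x * f x |f. schwartz f}"
  show "(\<lambda>x. chirp \<alpha> x * f x) \<in> ?X" using assms by blast
  fix h :: "real^'n \<Rightarrow> complex"
  assume "h \<in> ?X"
  then obtain f where h: "h = (\<lambda>x. chirp \<alpha> x * f x)" "schwartz f" by blast
  have der: "(h has_derivative (\<lambda>v. chirp \<alpha> x * frechet_derivative f (at x) v
      + chirp \<alpha> x * (\<i> * of_real (\<Sum>k\<in>UNIV. cot (\<alpha> $ k) * x $ k * v $ k)) * f x)) (at x)" for x
    unfolding h(1)
    by (intro has_derivative_mult has_derivative_chirp has_derivative_frechet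
          schwartz_differentiable h)
  show "h differentiable (at x)" for x
    using der unfolding differentiable_def by blast
  show "bounded (range (\<lambda>x. (1 + norm x) ^ N *\<^sub>R h x))" for N
    using schwartz_decay[OF h(2), of N] by (simp add: bounded_iff h(1) norm_mult)
  show "partial_deriv i h \<in> ?X" for i
  proof -
    have s: "(\<Sum>k\<in>UNIV. cot (\<alpha> $ k) * x $ k * axis i 1 $ k) = cot (\<alpha> $ i) * x $ i" for x :: "real^'n"
      by (subst sum.remove[of _ i]) (auto simp: axis_def intro!: sum.neutral)
    have "partial_deriv i h = (\<lambda>x. chirp \<alpha> x *
        (partial_deriv i f x + \<i> * of_real (cot (\<alpha> $ i)) * (of_real (x $ i) * f x)))"
      by (rule ext, subst partial_deriv_eq[OF der])
        (simp only: partial_deriv_def s, simp add: algebra_simps)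
    moreover have "schwartz (\<lambda>x. partial_deriv i f x
        + \<i> * of_real (cot (\<alpha> $ i)) * (of_real (x $ i) * f x))"
      by (intro schwartz_add schwartz_partial schwartz_coord h)
    ultimately show ?thesis by (intro CollectI exI conjI)
  qed
qed

lemma schwartz_chirp_iff: "schwartz (\<lambda>x. chirp \<alpha> x * f x) \<longleftrightarrow> schwartz f"
proof
  assume "schwartz (\<lambda>x. chirp \<alpha> x * f x)"
  from schwartz_chirp[OF this, of "- \<alpha>"] show "schwartz f" by simp
qed (rule schwartz_chirp)

lemma chirp_mult_distr_of_fun:
  "chirp_mult \<alpha> (distr_of_fun f) = distr_of_fun (\<lambda>x. chirp \<alpha> x * f x)"
  by (rule ext) (simp add: chirp_mult_def distr_of_fun_def schwartz_chirp_iff mult.assoc mult.left_commute)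

lemma chirp_measurable: "chirp \<alpha> \<in> borel_measurable lebesgue"
proof -
  have "continuous_on UNIV (chirp \<alpha>)"
    using has_derivative_chirp
    by (intro continuous_at_imp_continuous_on) (blast intro: has_derivative_continuous)
  then show ?thesis
    by (intro measurable_completion) (auto intro: borel_measurable_continuous_onI)
qed

lemma tempered_fun_chirp:
  assumes "tempered_fun f"
  shows "tempered_fun (\<lambda>x. chirp \<alpha> x * f x)"
proof -
  from assms obtain N where N: "integrable lebesgue (\<lambda>x. f x /\<^sub>R (1 + norm x) ^ N)"
    unfolding tempered_fun_def by blast
  have "integrable lebesgue (\<lambda>x. chirp \<alpha> x * (f x /\<^sub>R (1 + norm x) ^ N))"
  proof (rule Bochner_Integration.integrable_bound[OF N])
    show "(\<lambda>x. chirp \<alpha> x * (f x /\<^sub>R (1 + norm x) ^ N)) \<in> borel_measurable lebesgue"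
      by (intro borel_measurable_times chirp_measurable borel_measurable_integrable[OF N])
  qed (simp add: norm_mult)
  then show ?thesis unfolding tempered_fun_def by (auto intro!: exI[of _ N])
qed

lemma is_pv_integral_chirp:
  assumes "is_pv_integral (chirp_kernel \<alpha> K) f g"
  shows "is_pv_integral K (\<lambda>x. chirp \<alpha> x * f x) (\<lambda>x. chirp \<alpha> x * g x)"
  using assms unfolding is_pv_integral_def
proof (rule AE_mp, intro AE_I2 impI conjI allI)
  fix x
  assume *: "(\<forall>\<epsilon>>0. set_integrable lebesgue {y. \<epsilon> < dist x y} (\<lambda>y. chirp_kernel \<alpha> K x y * f y)) \<and>
    ((\<lambda>\<epsilon>. LINT y:{y. \<epsilon> < dist x y}|lebesgue. chirp_kernel \<alpha> K x y * f y) \<longlongrightarrow> g x) (at_right 0)"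
  have eq: "K x y * (chirp \<alpha> y * f y) = chirp \<alpha> x * (chirp_kernel \<alpha> K x y * f y)" for y
    by (simp add: chirp_kernel_def mult.assoc)
  show "set_integrable lebesgue {y. \<epsilon> < dist x y} (\<lambda>y. K x y * (chirp \<alpha> y * f y))" if "\<epsilon> > 0" for \<epsilon>
    unfolding eq using * that by (intro set_integrable_mult_right) auto
  have "((\<lambda>\<epsilon>. chirp \<alpha> x * (LINT y:{y. \<epsilon> < dist x y}|lebesgue. chirp_kernel \<alpha> K x y * f y))
      \<longlongrightarrow> chirp \<alpha> x * g x) (at_right 0)"
    using * by (intro tendsto_mult_left) auto
  then show "((\<lambda>\<epsilon>. LINT y:{y. \<epsilon> < dist x y}|lebesgue. K x y * (chirp \<alpha> y * f y))
      \<longlongrightarrow> chirp \<alpha> x * g x) (at_right 0)"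
    unfolding eq by simp
qed

lemma singular_integral_chirp_operator:
  assumes "singular_integral_operator K T"
  shows "singular_integral_operator (chirp_kernel \<alpha> K) (chirp_operator \<alpha> T)"
  unfolding singular_integral_operator_def
proof (intro allI impI)
  fix f g
  assume "tempered_fun f" "tempered_fun g" "is_pv_integral (chirp_kernel \<alpha> K) f g"
  then have "T (distr_of_fun (\<lambda>x. chirp \<alpha> x * f x)) = distr_of_fun (\<lambda>x. chirp \<alpha> x * g x)"
    by (intro assms[unfolded singular_integral_operator_def, rule_format]
        tempered_fun_chirp is_pv_integral_chirp)
  then show "chirp_operator \<alpha> T (distr_of_fun f) = distr_of_fun g"
    by (simp add: chirp_operator_def chirp_mult_distr_of_fun)
qed

end

theory Submission
  imports Defs
begin

text \<open>Multiplication by the chirp \<open>chirp \<alpha>\<close> is a bijection of the tempered distributions onto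
  themselves, with inverse the multiplication by \<open>chirp (- \<alpha>)\<close>. The chirp Hardy space
  is the preimage of the Hardy space under this bijection, with the norm pulled back, and
  \<open>chirp_operator \<alpha> T\<close> is the conjugate of \<open>T\<close>. Boundedness with a given constant \<open>C\<close> is therefore
  the same property on both sides.

  The one analytic point is that the bijection stays inside the tempered distributions, in other
  words that multiplication by the chirp is continuous on the Schwartz space. All partial
  derivatives of a chirp are the chirp times polynomials, and multiplication by a polynomial can be
  absorbed by the weights \<open>(1 + norm x) ^ N\<close> in the seminorms
  (\<open>schwartz_null_coord\<close>, \<open>schwartz_null_chirp\<close>).\<close>

section \<open>Null sequences of Schwartz functions\<close>

text \<open>Seminorms of every order are controlled at once: it suffices to find a family of sequences
  that is closed under partial derivatives and whose members converge to zero in the weighted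
  supremum norms of order zero.\<close>

lemma schwartz_null_coinduct:
  assumes "F \<in> X"
    and "\<And>F k. F \<in> X \<Longrightarrow> schwartz (F k)"
    and "\<And>F N. F \<in> X \<Longrightarrow>
      uniform_limit UNIV (\<lambda>k x. (1 + norm x) ^ N *\<^sub>R F k x) (\<lambda>x. 0) sequentially"
    and "\<And>F i. F \<in> X \<Longrightarrow> (\<lambda>k. partial_deriv i (F k)) \<in> X"
  shows "schwartz_null F"
proof -
  have "(\<lambda>k. iter_partial is (F k)) \<in> X" for "is"
    by (induction "is") (simp_all add: assms)
  from assms(3)[OF this] show ?thesis
    unfolding schwartz_null_def using assms(1,2) by blast
qed

lemma schwartz_null_schwartz: "schwartz_null F \<Longrightarrow> schwartz (F k)"
  by (simp add: schwartz_null_def)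

lemma schwartz_null_decay:
  "schwartz_null F \<Longrightarrow>
    uniform_limit UNIV (\<lambda>k x. (1 + norm x) ^ N *\<^sub>R F k x) (\<lambda>x. 0) sequentially"
  unfolding schwartz_null_def by (drule conjunct2, drule spec[of _ "[]"]) simp

lemma schwartz_null_partial:
  fixes F :: "nat \<Rightarrow> real^'n \<Rightarrow> complex"
  assumes "schwartz_null F"
  shows "schwartz_null (\<lambda>k. partial_deriv i (F k))"
  unfolding schwartz_null_def
proof (intro conjI allI)
  show "schwartz (partial_deriv i (F k))" for k
    by (intro schwartz_partial schwartz_null_schwartz assms)
  show "uniform_limit UNIV
      (\<lambda>k x. (1 + norm x) ^ N *\<^sub>R iter_partial is (partial_deriv i (F k)) x) (\<lambda>x. 0) sequentially"
    for "is" N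
    using assms[unfolded schwartz_null_def, THEN conjunct2, rule_format, of N "is @ [i]"] by simp
qed

section \<open>Algebra of partial derivatives of Schwartz functions\<close>

lemma partial_deriv_add:
  assumes "schwartz f" "schwartz g"
  shows "partial_deriv i (\<lambda>x. f x + c * g x) = (\<lambda>x. partial_deriv i f x + c * partial_deriv i g x)"
proof
  fix x
  have "((\<lambda>x. f x + c * g x) has_derivative
      (\<lambda>v. frechet_derivative f (at x) v + c * frechet_derivative g (at x) v)) (at x)"
    using assms
    by (intro has_derivative_add has_derivative_mult_right has_derivative_frechet
        schwartz_differentiable)
  from partial_deriv_eq[OF this]
  show "partial_deriv i (\<lambda>x. f x + c * g x) x = partial_deriv i f x + c * partial_deriv i g x"
    by (simp add: partial_deriv_def)
qed

lemma partial_deriv_coord: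
  assumes "schwartz f"
  shows "partial_deriv i (\<lambda>x. of_real (x $ j) * f x) =
    (\<lambda>x. of_real (x $ j) * partial_deriv i f x + of_real (axis i 1 $ j) * f x)"
proof
  fix x
  have "((\<lambda>x. of_real (x $ j) * f x) has_derivative
      (\<lambda>v. of_real (x $ j) * frechet_derivative f (at x) v + of_real (v $ j) * f x)) (at x)"
    by (intro has_derivative_mult has_derivative_of_real has_derivative_frechet
        schwartz_differentiable assms bounded_linear.has_derivative[OF bounded_linear_vec_nth]
        has_derivative_ident)
  from partial_deriv_eq[OF this]
  show "partial_deriv i (\<lambda>x. of_real (x $ j) * f x) x =
      of_real (x $ j) * partial_deriv i f x + of_real (axis i 1 $ j) * f x"
    by (simp add: partial_deriv_def)
qed

text \<open>The chirp can be factored out of every derivative of a product with it; what remains is again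
  a Schwartz function.\<close>

lemma partial_deriv_chirp:
  assumes "schwartz f"
  shows "partial_deriv i (\<lambda>x. chirp \<alpha> x * f x) =
    (\<lambda>x. chirp \<alpha> x * (partial_deriv i f x + \<i> * of_real (cot (\<alpha> $ i)) * (of_real (x $ i) * f x)))"
proof
  fix x
  have der: "((\<lambda>x. chirp \<alpha> x * f x) has_derivative (\<lambda>v. chirp \<alpha> x * frechet_derivative f (at x) v
      + chirp \<alpha> x * (\<i> * of_real (\<Sum>k\<in>UNIV. cot (\<alpha> $ k) * x $ k * v $ k)) * f x)) (at x)"
    by (intro has_derivative_mult has_derivative_chirp has_derivative_frechet
        schwartz_differentiable assms)
  have "(\<Sum>k\<in>UNIV. cot (\<alpha> $ k) * x $ k * axis i 1 $ k) = cot (\<alpha> $ i) * x $ i"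
    by (subst sum.remove[of _ i]) (auto simp: axis_def intro!: sum.neutral)
  then show "partial_deriv i (\<lambda>x. chirp \<alpha> x * f x) x =
      chirp \<alpha> x * (partial_deriv i f x + \<i> * of_real (cot (\<alpha> $ i)) * (of_real (x $ i) * f x))"
    by (subst partial_deriv_eq[OF der]) (simp add: partial_deriv_def algebra_simps)
qed

section \<open>Continuity of multiplication by the chirp\<close>

lemma schwartz_null_add:
  fixes F G :: "nat \<Rightarrow> real^'n \<Rightarrow> complex"
  assumes "schwartz_null F" "schwartz_null G"
  shows "schwartz_null (\<lambda>k x. F k x + c * G k x)"
proof (rule schwartz_null_coinduct
    [where X = "{\<lambda>k x. F k x + c * G k x |F G. schwartz_null F \<and> schwartz_null G}"])
  let ?X = "{\<lambda>k (x::real^'n). F k x + c * G k x |F G. schwartz_null F \<and> schwartz_null G}"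
  show "(\<lambda>k x. F k x + c * G k x) \<in> ?X"
    using assms by blast
  fix H assume "H \<in> ?X"
  then obtain F G where H: "H = (\<lambda>k x. F k x + c * G k x)" "schwartz_null F" "schwartz_null G"
    by blast
  show "schwartz (H k)" for k
    unfolding H(1) by (intro schwartz_add schwartz_null_schwartz H)
  show "uniform_limit UNIV (\<lambda>k x. (1 + norm x) ^ N *\<^sub>R H k x) (\<lambda>x. 0) sequentially" for N
  proof -
    have "uniform_limit UNIV (\<lambda>k x. (1 + norm x) ^ N *\<^sub>R F k x + c * ((1 + norm x) ^ N *\<^sub>R G k x))
        (\<lambda>x. 0 + c * 0) sequentially"
      by (intro uniform_limit_add bounded_linear.uniform_limit[OF bounded_linear_mult_right]
          schwartz_null_decay H)
    then show ?thesis
      by (simp add: H(1) scaleR_add_right)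
  qed
  show "(\<lambda>k. partial_deriv i (H k)) \<in> ?X" for i
  proof -
    have "(\<lambda>k. partial_deriv i (H k)) =
        (\<lambda>k x. partial_deriv i (F k) x + c * partial_deriv i (G k) x)"
      unfolding H(1) by (intro ext, subst partial_deriv_add) (simp_all add: H schwartz_null_schwartz)
    then show ?thesis
      using schwartz_null_partial[OF H(2), of i] schwartz_null_partial[OF H(3), of i]
      by (intro CollectI exI conjI)
  qed
qed

text \<open>The weight of exponent \<open>Suc N\<close> absorbs a coordinate factor under the weight of exponent
  \<open>N\<close>.\<close>

lemma schwartz_null_coord:
  fixes F :: "nat \<Rightarrow> real^'n \<Rightarrow> complex"
  assumes "schwartz_null F"
  shows "schwartz_null (\<lambda>k x. of_real (x $ j) * F k x)"
proof (rule schwartz_null_coinduct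
    \<comment> \<open>The second summand collects the terms in which the coordinate factor is differentiated.\<close>
    [where X = "{\<lambda>k x. of_real (x $ j) * F k x + G k x |F G. schwartz_null F \<and> schwartz_null G}"])
  let ?X = "{\<lambda>k (x::real^'n). of_real (x $ j) * F k x + G k x |F G. schwartz_null F \<and> schwartz_null G}"
  have "schwartz_null (\<lambda>k (x::real^'n). 0)"
    using schwartz_null_add[OF assms assms, of "- 1"] by simp
  with assms show "(\<lambda>k x. of_real (x $ j) * F k x) \<in> ?X"
    by (intro CollectI exI[of _ F] exI[of _ "\<lambda>k x. 0"]) auto
  fix H assume "H \<in> ?X"
  then obtain F G where
    H: "H = (\<lambda>k x. of_real (x $ j) * F k x + G k x)" "schwartz_null F" "schwartz_null G"
    by blast
  show "schwartz (H k)" for k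
    using schwartz_add[of "\<lambda>x. of_real (x $ j) * F k x" "G k" 1]
    by (simp add: H schwartz_coord schwartz_null_schwartz)
  show "uniform_limit UNIV (\<lambda>k x. (1 + norm x) ^ N *\<^sub>R H k x) (\<lambda>x. 0) sequentially" for N
  proof -
    have bound: "norm ((1 + norm x) ^ N *\<^sub>R (of_real (x $ j) * F k x))
        \<le> norm ((1 + norm x) ^ Suc N *\<^sub>R F k x)" for k x
    proof -
      have "\<bar>x $ j\<bar> \<le> 1 + norm x"
        using component_le_norm_cart[of x j] by simp
      then have "(1 + norm x) ^ N * (\<bar>x $ j\<bar> * norm (F k x))
          \<le> (1 + norm x) ^ N * ((1 + norm x) * norm (F k x))"
        by (intro mult_left_mono mult_right_mono) auto
      then show ?thesis
        unfolding norm_scaleR by (simp add: norm_mult mult.assoc mult.left_commute)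
    qed
    have "uniform_limit UNIV (\<lambda>k x. (1 + norm x) ^ N *\<^sub>R (of_real (x $ j) * F k x)) (\<lambda>x. 0)
        sequentially"
      by (rule metric_uniform_limit_imp_uniform_limit[OF schwartz_null_decay[OF H(2), of "Suc N"]])
        (simp only: dist_0_norm dist_commute[of _ 0] bound ball_UNIV simp_thms eventually_True)
    from uniform_limit_add[OF this schwartz_null_decay[OF H(3), of N]] show ?thesis
      by (simp add: H(1) scaleR_add_right)
  qed
  show "(\<lambda>k. partial_deriv i (H k)) \<in> ?X" for i
  proof -
    have "partial_deriv i (H k) = (\<lambda>x. of_real (x $ j) * partial_deriv i (F k) x +
        (partial_deriv i (G k) x + of_real (axis i 1 $ j) * F k x))" for k
      using partial_deriv_add[OF schwartz_coord[OF schwartz_null_schwartz[OF H(2)]]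
          schwartz_null_schwartz[OF H(3)], of i j k 1 k]
      by (simp add: H(1) partial_deriv_coord[OF schwartz_null_schwartz[OF H(2)]] add_ac)
    then have "(\<lambda>k. partial_deriv i (H k)) = (\<lambda>k x. of_real (x $ j) * partial_deriv i (F k) x +
        (partial_deriv i (G k) x + of_real (axis i 1 $ j) * F k x))"
      by blast
    moreover have "schwartz_null (\<lambda>k x. partial_deriv i (G k) x + of_real (axis i 1 $ j) * F k x)"
      by (intro schwartz_null_add schwartz_null_partial H)
    ultimately show ?thesis
      using schwartz_null_partial[OF H(2), of i] by (intro CollectI exI conjI)
  qed
qed

text \<open>The chirp has modulus one, so it is invisible to the seminorms of order zero. Each derivative
  leaves the chirp in place and costs one multiplication by a coordinate.\<close>

lemma schwartz_null_chirp:
  fixes F :: "nat \<Rightarrow> real^'n \<Rightarrow> complex"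
  assumes "schwartz_null F"
  shows "schwartz_null (\<lambda>k x. chirp \<alpha> x * F k x)"
proof (rule schwartz_null_coinduct[where X = "{\<lambda>k x. chirp \<alpha> x * F k x |F. schwartz_null F}"])
  let ?X = "{\<lambda>k x. chirp \<alpha> x * F k x |F. schwartz_null F}"
  show "(\<lambda>k x. chirp \<alpha> x * F k x) \<in> ?X"
    using assms by blast
  fix H assume "H \<in> ?X"
  then obtain F where H: "H = (\<lambda>k x. chirp \<alpha> x * F k x)" "schwartz_null F"
    by blast
  show "schwartz (H k)" for k
    unfolding H(1) by (intro schwartz_chirp schwartz_null_schwartz H)
  show "uniform_limit UNIV (\<lambda>k x. (1 + norm x) ^ N *\<^sub>R H k x) (\<lambda>x. 0) sequentially" for N
    by (rule metric_uniform_limit_imp_uniform_limit[OF schwartz_null_decay[OF H(2), of N]])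
      (simp add: H(1) norm_mult)
  show "(\<lambda>k. partial_deriv i (H k)) \<in> ?X" for i
  proof -
    have "(\<lambda>k. partial_deriv i (H k)) = (\<lambda>k x. chirp \<alpha> x *
        (partial_deriv i (F k) x + \<i> * of_real (cot (\<alpha> $ i)) * (of_real (x $ i) * F k x)))"
      unfolding H(1) by (rule ext) (rule partial_deriv_chirp[OF schwartz_null_schwartz[OF H(2)]])
    moreover have "schwartz_null (\<lambda>k x. partial_deriv i (F k) x
        + \<i> * of_real (cot (\<alpha> $ i)) * (of_real (x $ i) * F k x))"
      by (intro schwartz_null_add schwartz_null_partial schwartz_null_coord H)
    ultimately show ?thesis
      by (intro CollectI exI conjI)
  qed
qed

section \<open>The chirp Hardy space as a copy of the Hardy space\<close>

lemma tempered_chirp_mult: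
  fixes u :: "'n::finite distr"
  assumes "tempered u"
  shows "tempered (chirp_mult \<alpha> u)"
proof -
  note u = assms[unfolded tempered_def]
  note add = u[THEN conjunct1, rule_format]
    and scale = u[THEN conjunct2, THEN conjunct1, rule_format]
    and cont = u[THEN conjunct2, THEN conjunct2, THEN conjunct1, rule_format]
    and off = u[THEN conjunct2, THEN conjunct2, THEN conjunct2, rule_format]
  show ?thesis
    unfolding tempered_def chirp_mult_def
  proof (intro conjI allI impI)
    fix \<phi> \<psi> :: "real^'n \<Rightarrow> complex"
    assume "schwartz \<phi>" "schwartz \<psi>"
    then show "u (\<lambda>x. chirp \<alpha> x * (\<phi> x + \<psi> x)) = u (\<lambda>x. chirp \<alpha> x * \<phi> x) + u (\<lambda>x. chirp \<alpha> x * \<psi> x)"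
      unfolding distrib_left by (intro add schwartz_chirp)
  next
    fix c and \<phi> :: "real^'n \<Rightarrow> complex"
    assume "schwartz \<phi>"
    then show "u (\<lambda>x. chirp \<alpha> x * (c * \<phi> x)) = c * u (\<lambda>x. chirp \<alpha> x * \<phi> x)"
      unfolding mult.left_commute[of "chirp \<alpha> _" c] by (intro scale schwartz_chirp)
  next
    fix F :: "nat \<Rightarrow> real^'n \<Rightarrow> complex"
    assume "schwartz_null F"
    then show "(\<lambda>k. u (\<lambda>x. chirp \<alpha> x * F k x)) \<longlonglongrightarrow> 0"
      by (intro cont schwartz_null_chirp)
  next
    fix \<phi> :: "real^'n \<Rightarrow> complex"
    assume "\<not> schwartz \<phi>"
    then show "u (\<lambda>x. chirp \<alpha> x * \<phi> x) = 0"
      by (intro off) (simp add: schwartz_chirp_iff)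
  qed
qed

lemma chirp_mult_inverse [simp]:
  "chirp_mult \<alpha> (chirp_mult (- \<alpha>) u) = u" "chirp_mult (- \<alpha>) (chirp_mult \<alpha> u) = u"
  by (simp_all add: chirp_mult_def)

lemma chirp_mult_hardy_space_iff: "chirp_mult \<alpha> f \<in> hardy_space p \<longleftrightarrow> f \<in> chirp_hardy_space \<alpha> p"
proof -
  have "tempered f" if "bounded_distr (chirp_mult \<alpha> f)"
    using tempered_chirp_mult[of "chirp_mult \<alpha> f" "- \<alpha>"] that by (simp add: bounded_distr_def)
  then show ?thesis
    by (auto simp: hardy_space_def chirp_hardy_space_def)
qed

lemma chirp_hardy_space_eq_image: "chirp_hardy_space \<alpha> p = chirp_mult (- \<alpha>) ` hardy_space p"
proof (intro equalityI subsetI)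
  fix f assume "f \<in> chirp_hardy_space \<alpha> p"
  then have "chirp_mult (- \<alpha>) (chirp_mult \<alpha> f) \<in> chirp_mult (- \<alpha>) ` hardy_space p"
    by (intro imageI) (simp add: chirp_mult_hardy_space_iff)
  then show "f \<in> chirp_mult (- \<alpha>) ` hardy_space p"
    by simp
qed (auto simp: chirp_mult_hardy_space_iff[symmetric])

lemma chirp_hardy_norm_eq: "chirp_hardy_norm \<alpha> p f = hardy_norm p (chirp_mult \<alpha> f)"
  by (simp add: chirp_hardy_norm_def hardy_norm_def)

theorem theorem3p20:
  fixes p :: real
    and \<alpha> :: "real^'n"
    and K :: "real^'n \<Rightarrow> real^'n \<Rightarrow> complex"
    and T :: "'n distr \<Rightarrow> 'n distr"
  assumes "0 < p"
    and "\<And>k. \<alpha> $ k \<notin> range (\<lambda>m::int. pi * of_int m)"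
    and "singular_integral_operator K T"
  shows "bounded_operator_on (chirp_hardy_space \<alpha> p) (chirp_hardy_norm \<alpha> p) (chirp_operator \<alpha> T)
    \<longleftrightarrow> bounded_operator_on (hardy_space p) (hardy_norm p) T"
proof -
  have "chirp_operator \<alpha> T (chirp_mult (- \<alpha>) h) \<in> chirp_hardy_space \<alpha> p \<longleftrightarrow> T h \<in> hardy_space p"
    for h
    by (simp add: chirp_operator_def flip: chirp_mult_hardy_space_iff)
  then show ?thesis
    unfolding bounded_operator_on_def chirp_hardy_space_eq_image ball_simps
    by (simp add: chirp_hardy_norm_eq chirp_operator_def)
qed

end
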